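(* Let $G$ be a profinite group in which the word $w_o$ takes less than $2^{\aleph_0}$ values. Then the verbal subgroup $w_o(G)$ is finite.
   Context: For a group-word $w=w(x,y)$ and a profinite group $G$, a $w$-value in $G$ is an element of the form $w(a,b)$ with $a,b\in G$; "$w$ takes less than $2^{\aleph_0}$ values in $G$" means that the set of $w$-values has cardinality strictly less than $2^{\aleph_0}$. For a profinite group $G$, the verbal subgroup $w(G)$ is the closed subgroup of $G$ (topologically) generated by all $w$-values. The word $w_o$ (Olshanskii's word): for positive integers $d$ and $n$ set $$v(x,y)=[[x^d,y^d]^d,[y^d,x^{-d}]^d]$$ and $$w_o(x,y)=[x,y]\,v(x,y)^n[x,y]^{\varepsilon_1}v(x,y)^{n+1}\cdots [x,y]^{\varepsilon_{h-1}}v(x,y)^{n+h-1},$$ where $h\equiv 1 \pmod{10}$, $h>50000$, and $$\varepsilon_{10k+1}=\varepsilon_{10k+2}=\varepsilon_{10k+3}=\varepsilon_{10k+5}=\varepsilon_{10k+6}=1,$$ $$\varepsilon_{10k+4}=\varepsilon_{10k+7}=\varepsilon_{10k+8}=\varepsilon_{10k+9}=\varepsilon_{10k+10}=-1$$ for $k=0,1,2,\ldots$ (only $\varepsilon_1,\ldots,\varepsilon_{h-1}$ occur in the word). The parameters are fixed, as chosen by Olshanskii, so that the variety of groups in which $w_o$ is a law contains infinite non-abelian groups, all finite groups in this variety are abelian, and $w_o$ is not concise in the class of all groups (i.e. there is a group $H$ in which $w_o$ takes only finitely many values but the subgroup generated by the $w_o$-values is infinite). *)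

theory Defs
  imports "HOL-Analysis.Analysis" "HOL-Algebra.Generated_Groups"
begin

definition profinite_group :: "('a, 'b) monoid_scheme \<Rightarrow> 'a topology \<Rightarrow> bool" where
  "profinite_group G T \<longleftrightarrow>
     group G \<and> topspace T = carrier G \<and>
     continuous_map (prod_topology T T) T (\<lambda>(x, y). x \<otimes>\<^bsub>G\<^esub> y) \<and>
     continuous_map T T (\<lambda>x. inv\<^bsub>G\<^esub> x) \<and>
     compact_space T \<and> Hausdorff_space T \<and>
     (\<forall>x \<in> topspace T. connected_component_of_set T x = {x})"

(* Words in two variables are kept as formal expressions, so that one and the same
   word can be evaluated in groups with carriers of different types. *)
datatype gword = VarX | VarY | Mult gword gword | Inv gword | Pow gword int

primrec eval_word :: "('a, 'b) monoid_scheme \<Rightarrow> 'a \<Rightarrow> 'a \<Rightarrow> gword \<Rightarrow> 'a" where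
  "eval_word G a b VarX = a"
| "eval_word G a b VarY = b"
| "eval_word G a b (Mult u w) = eval_word G a b u \<otimes>\<^bsub>G\<^esub> eval_word G a b w"
| "eval_word G a b (Inv u) = inv\<^bsub>G\<^esub> (eval_word G a b u)"
| "eval_word G a b (Pow u k) = eval_word G a b u [^]\<^bsub>G\<^esub> k"

definition word_values :: "gword \<Rightarrow> ('a, 'b) monoid_scheme \<Rightarrow> 'a set" where
  "word_values w G = {eval_word G a b w | a b. a \<in> carrier G \<and> b \<in> carrier G}"

definition verbal_subgroup :: "gword \<Rightarrow> ('a, 'b) monoid_scheme \<Rightarrow> 'a topology \<Rightarrow> 'a set" where
  "verbal_subgroup w G T = T closure_of (generate G (word_values w G))"

(* The convention [u,w] = u w u^-1 w^-1 is Olshanskii's, and also that of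
   the constant derived_set in HOL-Algebra. *)
definition Comm :: "gword \<Rightarrow> gword \<Rightarrow> gword" where
  "Comm u w = Mult (Mult (Mult u w) (Inv u)) (Inv w)"

definition v_word :: "nat \<Rightarrow> gword" where
  "v_word d =
     Comm (Pow (Comm (Pow VarX (int d)) (Pow VarY (int d))) (int d))
          (Pow (Comm (Pow VarY (int d)) (Pow VarX (- int d))) (int d))"

definition eps :: "nat \<Rightarrow> int" where
  "eps i = (if i mod 10 \<in> {1, 2, 3, 5, 6} then 1 else - 1)"

(* [x,y] v^n [x,y]^(eps 1) v^(n+1) ... [x,y]^(eps j) v^(n+j) *)
primrec olshanskii_prefix :: "nat \<Rightarrow> nat \<Rightarrow> nat \<Rightarrow> gword" where
  "olshanskii_prefix d n 0 = Mult (Comm VarX VarY) (Pow (v_word d) (int n))"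
| "olshanskii_prefix d n (Suc j) =
     Mult (Mult (olshanskii_prefix d n j) (Pow (Comm VarX VarY) (eps (Suc j))))
          (Pow (v_word d) (int (n + Suc j)))"

definition olshanskii_word :: "nat \<Rightarrow> nat \<Rightarrow> nat \<Rightarrow> gword" where
  "olshanskii_word d n h = olshanskii_prefix d n (h - 1)"

definition in_variety :: "gword \<Rightarrow> ('a, 'b) monoid_scheme \<Rightarrow> bool" where
  "in_variety w H \<longleftrightarrow>
     group H \<and> (\<forall>a \<in> carrier H. \<forall>b \<in> carrier H. eval_word H a b w = \<one>\<^bsub>H\<^esub>)"

(* HOL cannot quantify over the carrier type inside a formula.  Groups on subsets of nat
   lose nothing in the last three conjuncts: every finite group is isomorphic to one; an
   infinite non-abelian group in the variety has a countable such subgroup; and if w has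
   finitely many values in H but these generate an infinite subgroup, the same holds in the
   countable subgroup generated by finitely many pairs (a, b) realising all the values. *)
definition olshanskii_parameters :: "nat \<Rightarrow> nat \<Rightarrow> nat \<Rightarrow> bool" where
  "olshanskii_parameters d n h \<longleftrightarrow>
     d > 0 \<and> n > 0 \<and> h > 50000 \<and> h mod 10 = 1 \<and>
     (\<exists>H :: nat monoid. in_variety (olshanskii_word d n h) H \<and>
        infinite (carrier H) \<and> \<not> comm_group H) \<and>
     (\<forall>H :: nat monoid. in_variety (olshanskii_word d n h) H \<and>
        finite (carrier H) \<longrightarrow> comm_group H) \<and>
     (\<exists>H :: nat monoid. group H \<and> finite (word_values (olshanskii_word d n h) H) \<and>
        infinite (generate H (word_values (olshanskii_word d n h) H)))"

end

theory Submission
  imports Defs "HOL-Algebra.SndIsomorphismGrp" "HOL-Algebra.Multiplicative_Group"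
begin

text \<open>Write \<open>w\<close> for Olshanskii's word. Two of its features matter. It collapses to the commutator \<open>[x,y]\<close>
whenever the subword \<open>v\<close> vanishes, because its signs add up to zero
(\<open>olshanskii_word_eq_commutator\<close>); and finite groups in which it is a law are abelian.

If \<open>w\<close> has fewer than \<open>2 ^ \<aleph>\<^sub>0\<close> values, certain configurations cannot occur, since
infinite products over arbitrary sets of indices would produce that many values
(\<open>continuum_many_values\<close>). Let \<open>FC\<close> be the set of elements with open centralizer. A first
application shows that an element with few conjugates lies in \<open>FC\<close>; in particular every \<open>w\<close>-value does
(\<open>word_values_in_FC\<close>). A second one shows that \<open>w\<close> is a law on \<open>FC \<inter> C\<close> for some open normal
subgroup \<open>C\<close> (\<open>word_law_on_FC_near_one\<close>).

Looking at finite quotients, \<open>FC \<inter> C\<close> is abelian and \<open>[G,G]\<close> lies in the closure of \<open>FC\<close>, so \<open>C\<close> is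
metabelian (\<open>exists_metabelian_open_normal\<close>). On \<open>C\<close> the word is therefore a commutator, and
\<open>x g x\<inverse> = w(x,g) g\<close> shows that the elements \<open>g\<close> of \<open>C\<close> have few conjugates under \<open>C\<close>. So
\<open>C \<subseteq> FC\<close>, which makes \<open>C = FC \<inter> C\<close> abelian. For \<open>x \<in> C\<close> and arbitrary \<open>g\<close> the word is now a
commutator again, and the same computation gives \<open>FC = G\<close>. A group all of whose elements have open
centralizer and which has an open abelian normal subgroup is finite over its centre; by Schur's theorem
\<open>[G,G]\<close> is finite. As \<open>[G,G]\<close> contains all \<open>w\<close>-values, the subgroup that they generate is finite, hence
closed.\<close>

section \<open>Evaluation of words\<close>

lemma (in group) eval_word_closed [simp, intro]:
  "a \<in> carrier G \<Longrightarrow> b \<in> carrier G \<Longrightarrow> eval_word G a b w \<in> carrier G"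
  by (induction w) auto

lemma eval_word_hom:
  assumes "group G" "group H" "f \<in> hom G H" "a \<in> carrier G" "b \<in> carrier G"
  shows "f (eval_word G a b w) = eval_word H (f a) (f b) w"
proof -
  interpret group_hom G H f
    using assms by (simp add: group_hom_def group_hom_axioms_def)
  show ?thesis
    using assms(4,5) by (induction w) (simp_all add: hom_int_pow G.eval_word_closed)
qed

lemma (in group) eval_word_in_subgroup:
  assumes "subgroup H G" "a \<in> H" "b \<in> H"
  shows "eval_word G a b w \<in> H"
  using assms subgroup_int_pow_closed
  by (induction w) (auto simp: subgroup.m_closed subgroup.m_inv_closed)

lemma (in group) inv_cancel_left:
  assumes "a \<in> carrier G" "x \<in> carrier G"
  shows "inv a \<otimes> (a \<otimes> x) = x" "a \<otimes> (inv a \<otimes> x) = x"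
  using assms by (simp_all add: m_assoc[symmetric])

lemma (in group) inv_commute:
  assumes "a \<in> carrier G" "z \<in> carrier G" "a \<otimes> z = z \<otimes> a"
  shows "inv a \<otimes> z = z \<otimes> inv a"
proof -
  have "z \<otimes> inv a = inv a \<otimes> (a \<otimes> z) \<otimes> inv a"
    using assms(1,2) by (simp add: m_assoc inv_cancel_left)
  then show ?thesis using assms by (simp add: m_assoc)
qed

lemma (in group) conj_hom:
  assumes "g \<in> carrier G"
  shows "(\<lambda>x. g \<otimes> x \<otimes> inv g) \<in> hom G G"
proof (rule homI)
  fix x y assume "x \<in> carrier G" "y \<in> carrier G"
  then show "g \<otimes> (x \<otimes> y) \<otimes> inv g = (g \<otimes> x \<otimes> inv g) \<otimes> (g \<otimes> y \<otimes> inv g)"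
    using assms by (metis (no_types, lifting) inv_closed inv_solve_right m_assoc m_closed)
qed (use assms in auto)

lemma (in group) eval_word_conj:
  assumes "g \<in> carrier G" "a \<in> carrier G" "b \<in> carrier G"
  shows "g \<otimes> eval_word G a b w \<otimes> inv g = eval_word G (g \<otimes> a \<otimes> inv g) (g \<otimes> b \<otimes> inv g) w"
  using eval_word_hom[OF group_axioms group_axioms conj_hom[OF assms(1)] assms(2,3)] .

text \<open>Modulo a normal subgroup a word value depends only on the classes of the two arguments, because
the projection to the quotient commutes with evaluation. This is the only form of continuity of
word maps that the argument needs.\<close>

lemma (in normal) eval_word_cong_cosets:
  assumes "a \<in> carrier G" "b \<in> carrier G" "a' \<in> carrier G" "b' \<in> carrier G"
    and "H #> a = H #> a'" "H #> b = H #> b'"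
  shows "H #> eval_word G a b w = H #> eval_word G a' b' w"
  using eval_word_hom[OF group_axioms factorgroup_is_group r_coset_hom_Mod] assms by metis

text \<open>Multiplication \<open>P \<times> Q \<rightarrow> G\<close> is a homomorphism when \<open>P\<close> and \<open>Q\<close> commute elementwise, and
homomorphisms commute with evaluation. So values at arguments that commute with each other
multiply; this is how many values are manufactured from a few nontrivial ones.\<close>

lemma (in group) eval_word_mult_commuting:
  assumes P: "subgroup P G" and Q: "subgroup Q G"
    and comm: "\<And>p q. p \<in> P \<Longrightarrow> q \<in> Q \<Longrightarrow> p \<otimes> q = q \<otimes> p"
    and "a \<in> P" "b \<in> P" "x \<in> Q" "y \<in> Q"
  shows "eval_word G (a \<otimes> x) (b \<otimes> y) w = eval_word G a b w \<otimes> eval_word G x y w"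
proof -
  have car: "p \<in> carrier G" if "p \<in> P \<or> p \<in> Q" for p
    using that P Q subgroup.mem_carrier by metis
  have swap: "(p \<otimes> q) \<otimes> (p' \<otimes> q') = (p \<otimes> p') \<otimes> (q \<otimes> q')"
    if "p \<in> P" "p' \<in> P" "q \<in> Q" "q' \<in> Q" for p p' q q'
    using that car comm[of p' q] by (metis m_assoc m_closed)
  have inP: "eval_word G a b u \<in> P" and inQ: "eval_word G x y u \<in> Q" for u
    using eval_word_in_subgroup P Q assms(4-) by auto
  show ?thesis
  proof (induction w)
    case (Mult u w)
    then show ?case using swap inP inQ by simp
  next
    case (Inv u)
    then show ?case
      using inP[of u] inQ[of u] car comm[of "inv (eval_word G a b u)" "inv (eval_word G x y u)"]
        P Q by (simp add: inv_mult_group subgroup.m_inv_closed)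
  next
    case (Pow u k)
    show ?case
      using Pow int_pow_mult_distrib[OF comm[OF inP inQ]] inP inQ car by simp
  qed simp_all
qed

section \<open>Olshanskii's word and commutators\<close>

abbreviation (in group) commutator :: "'a \<Rightarrow> 'a \<Rightarrow> 'a" where
  "commutator a b \<equiv> a \<otimes> b \<otimes> inv a \<otimes> inv b"

lemma (in group) commutator_eq_one_iff:
  assumes "a \<in> carrier G" "b \<in> carrier G"
  shows "commutator a b = \<one> \<longleftrightarrow> a \<otimes> b = b \<otimes> a"
proof -
  have "commutator a b = (a \<otimes> b) \<otimes> inv (b \<otimes> a)"
    using assms by (simp add: inv_mult_group m_assoc)
  then show ?thesis using assms by (metis inv_closed inv_equality inv_inv m_closed r_inv)
qed

text \<open>Each block of ten consecutive signs contains five \<open>+1\<close> and five \<open>-1\<close>.\<close>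

lemma sum_eps_period: "(\<Sum>i=1..10 * k. eps i) = 0"
proof (induction k)
  case (Suc k)
  have "{1..10 * Suc k} = {1..10 * k} \<union> {10 * k + 1..10 * k + 10}" by auto
  then have "(\<Sum>i=1..10 * Suc k. eps i) = (\<Sum>i=1..10 * k. eps i) + (\<Sum>i=10 * k + 1..10 * k + 10. eps i)"
    by (simp add: sum.union_disjoint)
  also have "(\<Sum>i=10 * k + 1..10 * k + 10. eps i) = (\<Sum>i=1..10. eps (i + 10 * k))"
    by (subst sum.shift_bounds_cl_nat_ivl[symmetric]) (simp add: add.commute)
  also have "\<dots> = (\<Sum>i=1..10::nat. eps i)"
    by (simp add: eps_def)
  also have "{1..10::nat} = {1, 2, 3, 4, 5, 6, 7, 8, 9, 10}"
    by (simp add: atLeastAtMost_insertL[symmetric] numeral_eq_Suc)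
  also have "(\<Sum>i\<in>\<dots>. eps i) = 0"
    by (simp add: eps_def)
  finally show ?case using Suc.IH by simp
qed simp

lemma (in group) olshanskii_prefix_when_v_trivial:
  assumes "a \<in> carrier G" "b \<in> carrier G" "eval_word G a b (v_word d) = \<one>"
  shows "eval_word G a b (olshanskii_prefix d n j)
     = commutator a b [^] (1 + (\<Sum>i=1..j. eps i))"
proof (induction j)
  case (Suc j)
  have "commutator a b \<in> carrier G" using assms by simp
  then show ?case
    using Suc assms by (simp add: Comm_def int_pow_mult[symmetric] add.assoc)
qed (use assms in \<open>simp add: Comm_def\<close>)

text \<open>Where the two commutators inside \<open>v\<close> commute, \<open>v\<close> is trivial and the word collapses to
\<open>[a,b]\<close> raised to \<open>1\<close> plus the sum of the first \<open>h - 1\<close> signs. As \<open>h - 1\<close> is a multiple of ten,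
that sum vanishes. In particular the word is a plain commutator on every metabelian group, and
also when one argument lies in an abelian normal subgroup.\<close>

lemma (in group) olshanskii_word_eq_commutator:
  assumes "a \<in> carrier G" "b \<in> carrier G" "h mod 10 = 1"
    and comm: "commutator (a [^] int d) (b [^] int d) \<otimes> commutator (b [^] int d) (a [^] (- int d))
      = commutator (b [^] int d) (a [^] (- int d)) \<otimes> commutator (a [^] int d) (b [^] int d)"
  shows "eval_word G a b (olshanskii_word d n h) = commutator a b"
proof -
  have "eval_word G a b (v_word d) = \<one>"
    unfolding v_word_def Comm_def using assms(1,2) comm
    by (simp add: commutator_eq_one_iff int_pow_int) (metis group_commutes_pow int_pow_closed inv_closed m_closed nat_pow_closed)
  moreover have "h - 1 = 10 * (h div 10)"
    using assms(3) by presburger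
  ultimately show ?thesis
    using assms(1,2) sum_eps_period[of "h div 10"]
    by (simp add: olshanskii_word_def olshanskii_prefix_when_v_trivial del: One_nat_def)
qed

lemma (in group) olshanskii_word_in_derived:
  assumes "a \<in> carrier G" "b \<in> carrier G"
  shows "eval_word G a b (olshanskii_word d n h) \<in> derived G (carrier G)"
proof -
  interpret D: subgroup "derived G (carrier G)" G
    by (simp add: derived_is_subgroup)
  have comm: "eval_word G a b (Comm u w) \<in> derived G (carrier G)" for u w
  proof -
    have "commutator p q \<in> derived G (carrier G)" if "p \<in> carrier G" "q \<in> carrier G" for p q
      unfolding derived_def using that by (intro generate.incl) blast
    then show ?thesis using assms by (simp add: Comm_def)
  qed
  have "eval_word G a b (olshanskii_prefix d n j) \<in> derived G (carrier G)" for j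
    using comm[of VarX VarY] comm[of "Pow (Comm (Pow VarX (int d)) (Pow VarY (int d))) (int d)"
        "Pow (Comm (Pow VarY (int d)) (Pow VarX (- int d))) (int d)"]
    unfolding v_word_def[symmetric]
    by (induction j) (auto simp: subgroup_int_pow_closed[OF D.subgroup_axioms])
  then show ?thesis by (simp add: olshanskii_word_def)
qed

section \<open>Finite quotients\<close>

text \<open>The image of \<open>H\<close> in \<open>G Mod M\<close> is a finite group in which \<open>w\<close> is a law. The hypothesis speaks about
groups of natural numbers only, so the image is transported along an injection \<open>\<phi>\<close> of the cosets
into \<^typ>\<open>nat\<close>; the homomorphic image of a group is a group whatever the ambient structure is. The
image is then commutative, which says that commutators of elements of \<open>H\<close> lie in \<open>M\<close>.\<close>

lemma (in group) commutator_in_normal_if_word_law: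
  assumes fin: "\<And>H :: nat monoid. in_variety w H \<Longrightarrow> finite (carrier H) \<Longrightarrow> comm_group H"
    and H: "subgroup H G" and M: "M \<lhd> G" and idx: "finite (rcosets M)"
    and law: "\<And>a b. a \<in> H \<Longrightarrow> b \<in> H \<Longrightarrow> eval_word G a b w \<in> M"
    and ab: "a \<in> H" "b \<in> H"
  shows "commutator a b \<in> M"
proof -
  interpret M: normal M G by fact
  interpret Q: group "G Mod M" by (rule M.factorgroup_is_group)
  define K where "K = G\<lparr>carrier := H\<rparr>"
  interpret K: group K unfolding K_def using H by (rule subgroup_imp_group)
  have HG: "x \<in> carrier G" if "x \<in> H" for x
    using H that by (rule subgroup.mem_carrier)
  obtain \<phi> :: "'a set \<Rightarrow> nat" where \<phi>: "inj_on \<phi> (rcosets M)"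
    using finite_imp_inj_to_nat_seg[OF idx] by blast
  \<comment> \<open>Off the range of \<open>\<phi>\<close> this multiplication is junk; only the image of \<open>f\<close> below is a group.\<close>
  define N where "N = \<lparr>carrier = (UNIV :: nat set),
     mult = (\<lambda>i j. \<phi> (inv_into (rcosets M) \<phi> i <#> inv_into (rcosets M) \<phi> j)), one = \<phi> M\<rparr>"
  define f where "f = (\<lambda>x. \<phi> (M #> x))"
  have cos: "M #> x \<in> rcosets M" if "x \<in> carrier G" for x
    using that by (simp add: M.subset rcosetsI)
  have f: "f \<in> hom K N"
    unfolding hom_def using HG cos \<phi> M.rcos_sum by (auto simp: K_def N_def f_def)
  define F where "F = N\<lparr>carrier := f ` carrier K, one := f \<one>\<^bsub>K\<^esub>\<rparr>"
  interpret F: group F unfolding F_def by (rule K.hom_imp_img_group[OF f])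
  have fF: "f \<in> hom K F" using f unfolding F_def hom_def by auto
  have eK: "eval_word K x y u = eval_word G x y u" if "x \<in> H" "y \<in> H" for x y u
    using that
  proof (induction u)
    case (Inv u)
    then show ?case
      using m_inv_consistent[OF H] eval_word_in_subgroup[OF H] by (simp add: K_def)
  next
    case (Pow u k)
    then show ?case
      using int_pow_consistent[OF H] eval_word_in_subgroup[OF H] by (simp add: K_def)
  qed (auto simp: K_def)
  have one: "f x = \<one>\<^bsub>F\<^esub> \<longleftrightarrow> x \<in> M" if "x \<in> H" for x
  proof -
    have "f x = \<one>\<^bsub>F\<^esub> \<longleftrightarrow> M #> x = M #> \<one>"
      using cos[OF HG[OF that]] cos[OF one_closed] \<phi>
      by (auto simp: F_def f_def K_def N_def inj_on_eq_iff)
    then show ?thesis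
      using that HG M.subset coset_join1 coset_join2 M.subgroup_axioms by (metis coset_mult_one)
  qed
  have "in_variety w F"
    unfolding in_variety_def
  proof (intro conjI ballI)
    fix x y assume "x \<in> carrier F" "y \<in> carrier F"
    then obtain p q where pq: "p \<in> H" "q \<in> H" "x = f p" "y = f q"
      by (auto simp: F_def K_def)
    have "eval_word F x y w = f (eval_word K p q w)"
      using eval_word_hom[OF K.group_axioms F.group_axioms fF] pq by (simp add: K_def)
    also have "\<dots> = \<one>\<^bsub>F\<^esub>"
      using one eK law pq eval_word_in_subgroup[OF H] by metis
    finally show "eval_word F x y w = \<one>\<^bsub>F\<^esub>" .
  qed (rule F.group_axioms)
  moreover have "finite (carrier F)"
  proof -
    have "carrier F \<subseteq> \<phi> ` (rcosets M)" using cos HG by (auto simp: F_def f_def K_def)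
    then show ?thesis using idx finite_surj by blast
  qed
  ultimately interpret F: comm_group F using fin by blast
  have "f (eval_word K a b (Comm VarX VarY)) = eval_word F (f a) (f b) (Comm VarX VarY)"
    using eval_word_hom[OF K.group_axioms F.group_axioms fF] ab by (simp add: K_def)
  also have "\<dots> = \<one>\<^bsub>F\<^esub>"
  proof -
    have "f a \<in> carrier F" "f b \<in> carrier F" using ab by (auto simp: F_def K_def)
    then show ?thesis
      unfolding Comm_def using F.commutator_eq_one_iff F.m_comm by simp
  qed
  finally have "f (commutator a b) = \<one>\<^bsub>F\<^esub>"
    using eK[OF ab, of "Comm VarX VarY"] by (simp add: Comm_def)
  then show ?thesis
    using one[of "commutator a b"] ab H by (simp add: subgroup.m_closed subgroup.m_inv_closed)
qed

section \<open>Schur's theorem on groups that are finite over their centre\<close>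

context group begin

abbreviation product_of_list :: "'a list \<Rightarrow> 'a" where
  "product_of_list xs \<equiv> foldr (\<otimes>) xs \<one>"

lemma product_of_list_closed [simp]: "set xs \<subseteq> carrier G \<Longrightarrow> product_of_list xs \<in> carrier G"
  by (induction xs) auto

lemma product_of_list_append:
  "set xs \<subseteq> carrier G \<Longrightarrow> set ys \<subseteq> carrier G \<Longrightarrow>
     product_of_list (xs @ ys) = product_of_list xs \<otimes> product_of_list ys"
  by (induction xs) (auto simp: m_assoc)

lemma product_of_list_replicate:
  "c \<in> carrier G \<Longrightarrow> product_of_list (replicate m c) = c [^] m"
  by (induction m) (simp, metis foldr_Cons comp_apply nat_pow_Suc2 replicate_Suc)

text \<open>A factor \<open>c\<close> can be moved to the front of a product at the price of conjugating the factors that it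
passes, and \<open>S\<close> is closed under conjugation.\<close>

lemma product_of_list_collect_occurrences:
  assumes S: "S \<subseteq> carrier G"
    and conj: "\<And>g x. g \<in> carrier G \<Longrightarrow> x \<in> S \<Longrightarrow> g \<otimes> x \<otimes> inv g \<in> S"
    and c: "c \<in> S"
    and "set xs \<subseteq> S" "m \<le> count_list xs c"
  shows "\<exists>ys. set ys \<subseteq> S \<and> m + length ys = length xs \<and>
    product_of_list xs = c [^] m \<otimes> product_of_list ys"
  using assms(4,5)
proof (induction xs arbitrary: m)
  case (Cons a xs)
  have aS: "a \<in> S" and car: "a \<in> carrier G" "c \<in> carrier G" using Cons S c by auto
  show ?case
  proof (cases "a = c \<and> m > 0")
    case True
    then have "m - 1 \<le> count_list xs c" "set xs \<subseteq> S"
      using Cons.prems by auto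
    then obtain ys where ys: "set ys \<subseteq> S" "m - 1 + length ys = length xs"
      "product_of_list xs = c [^] (m - 1) \<otimes> product_of_list ys"
      using Cons.IH by blast
    have "product_of_list (a # xs) = c \<otimes> c [^] (m - 1) \<otimes> product_of_list ys"
      using True ys S car by (simp add: m_assoc subset_trans)
    also have "c \<otimes> c [^] (m - 1) = c [^] m"
      using True car by (metis Suc_pred' nat_pow_Suc2)
    finally have "product_of_list (a # xs) = c [^] m \<otimes> product_of_list ys" .
    moreover have "m + length ys = length (a # xs)"
      using True ys(2) by (cases m) auto
    ultimately show ?thesis using ys(1) by blast
  next
    case False
    then obtain ys where ys: "set ys \<subseteq> S" "m + length ys = length xs"
      "product_of_list xs = c [^] m \<otimes> product_of_list ys"
      using Cons.IH[of m] Cons.prems by (auto split: if_splits)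
    have ysG: "product_of_list ys \<in> carrier G" using ys S by auto
    define a' where "a' = inv (c [^] m) \<otimes> a \<otimes> inv (inv (c [^] m))"
    have a': "a' \<in> S" unfolding a'_def by (rule conj[OF _ aS]) (use car in simp)
    have "c [^] m \<otimes> a' = a \<otimes> c [^] m"
      unfolding a'_def using car by (simp add: m_assoc[symmetric])
    moreover have "a' \<in> carrier G" using a' S by blast
    ultimately have "a \<otimes> (c [^] m \<otimes> product_of_list ys) = c [^] m \<otimes> (a' \<otimes> product_of_list ys)"
      using ysG car by (metis m_assoc nat_pow_closed)
    then have "product_of_list (a # xs) = c [^] m \<otimes> product_of_list (a' # ys)"
      using ys(3) by simp
    then show ?thesis
      using ys(1,2) a' by (intro exI[of _ "a' # ys"] conjI) simp_all
  qed
qed auto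

lemma generate_eq_products_of_lists:
  assumes S: "S \<subseteq> carrier G" and inv: "\<And>x. x \<in> S \<Longrightarrow> inv x \<in> S"
  shows "g \<in> generate G S \<Longrightarrow> \<exists>xs. set xs \<subseteq> S \<and> g = product_of_list xs"
proof (induction rule: generate.induct)
  case one
  show ?case by (intro exI[of _ "[]"]) auto
next
  case (incl x)
  then show ?case using S by (intro exI[of _ "[x]"]) auto
next
  case (inv x)
  then show ?case using S assms(2)[of x] by (intro exI[of _ "[inv x]"]) auto
next
  case (eng x y)
  then obtain xs ys where "set xs \<subseteq> S" "x = product_of_list xs" "set ys \<subseteq> S" "y = product_of_list ys"
    by auto
  then show ?case
    using S by (intro exI[of _ "xs @ ys"]) (auto simp: product_of_list_append simp del: foldr_append)
qed

text \<open>If \<open>c ^ (m + 1)\<close> can always be written with \<open>m\<close> factors, a product of minimal length contains no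
factor more than \<open>m\<close> times: otherwise collect \<open>m + 1\<close> copies of it in front and replace them. So
minimal products have length at most \<open>card S * m\<close>, and there are finitely many of them.\<close>

lemma finite_generate_if_powers_shorten:
  assumes S: "S \<subseteq> carrier G" and fin: "finite S"
    and inv: "\<And>x. x \<in> S \<Longrightarrow> inv x \<in> S"
    and conj: "\<And>g x. g \<in> carrier G \<Longrightarrow> x \<in> S \<Longrightarrow> g \<otimes> x \<otimes> inv g \<in> S"
    and short: "\<And>c. c \<in> S \<Longrightarrow> \<exists>zs. set zs \<subseteq> S \<and> length zs = m \<and> c [^] Suc m = product_of_list zs"
  shows "finite (generate G S)"
proof -
  have "\<exists>xs. set xs \<subseteq> S \<and> length xs \<le> card S * m \<and> g = product_of_list xs"
    if "g \<in> generate G S" for g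
  proof -
    define P where "P = (\<lambda>xs. set xs \<subseteq> S \<and> g = product_of_list xs)"
    have "\<exists>xs. P xs"
      using generate_eq_products_of_lists[OF S inv that] by (simp add: P_def)
    then obtain xs where xs: "P xs" and min: "\<And>ys. P ys \<Longrightarrow> length xs \<le> length ys"
      using ex_has_least_nat[of P _ length] by blast
    have "length xs \<le> card S * m"
    proof (rule ccontr)
      assume long: "\<not> length xs \<le> card S * m"
      have "\<exists>c\<in>S. Suc m \<le> count_list xs c"
      proof (rule ccontr)
        assume "\<not> ?thesis"
        then have "sum (count_list xs) S \<le> card S * m"
          using sum_bounded_above[of S "count_list xs" m] by (force simp: not_less_eq_eq)
        then show False
          using long xs sum_count_set[of xs S] fin by (simp add: P_def)
      qed
      then obtain c where c: "c \<in> S" "Suc m \<le> count_list xs c" by blast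
      obtain ys where ys: "set ys \<subseteq> S" "Suc m + length ys = length xs"
        "g = c [^] Suc m \<otimes> product_of_list ys"
        using product_of_list_collect_occurrences[OF S conj c(1) _ c(2)] xs unfolding P_def by metis
      obtain zs where zs: "set zs \<subseteq> S" "length zs = m" "c [^] Suc m = product_of_list zs"
        using short[OF c(1)] by blast
      have "P (zs @ ys)"
        using ys zs S by (simp add: P_def product_of_list_append subset_trans del: foldr_append nat_pow_Suc)
      then show False
        using min[of "zs @ ys"] ys(2) zs(2) by simp
    qed
    then show ?thesis using xs by (auto simp: P_def)
  qed
  then have "generate G S \<subseteq> product_of_list ` {xs. set xs \<subseteq> S \<and> length xs \<le> card S * m}"
    by blast
  then show ?thesis
    using finite_surj[OF finite_lists_length_le[OF fin]] by blast
qed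

text \<open>With \<open>c = [a,b]\<close> one has \<open>[a, b^2] = c (b c b\<inverse>)\<close>. If a power of \<open>c\<close> commutes with \<open>b\<close>, it can be moved
past \<open>b\<close>, and this identity then absorbs two factors \<open>c\<close> into the single commutator \<open>[a, b^2]\<close>; what
is left over becomes conjugates of \<open>c\<close>, that is, commutators again.\<close>

lemma commutator_power_shortens:
  assumes ab: "a \<in> carrier G" "b \<in> carrier G"
    and central: "commutator a b [^] Suc m \<otimes> b = b \<otimes> commutator a b [^] Suc m"
  shows "commutator a b [^] Suc (Suc m)
    = commutator a (b \<otimes> b) \<otimes> (b \<otimes> commutator a b \<otimes> inv b) [^] m"
proof -
  define c where "c = commutator a b"
  have c: "c \<in> carrier G" using ab by (simp add: c_def)
  have conj: "(b \<otimes> c \<otimes> inv b) [^] m = b \<otimes> c [^] m \<otimes> inv b"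
  proof (induction m)
    case (Suc m)
    then show ?case using ab c
      by (simp add: m_assoc) (metis inv_closed l_inv l_one m_assoc m_closed nat_pow_closed)
  qed (use ab in simp)
  have 1: "commutator a (b \<otimes> b) = c \<otimes> b \<otimes> c \<otimes> inv b"
  proof -
    have "c \<otimes> b = a \<otimes> b \<otimes> inv a" using ab by (simp add: c_def m_assoc)
    then have "c \<otimes> b \<otimes> c = a \<otimes> b \<otimes> inv a \<otimes> (a \<otimes> b \<otimes> inv a \<otimes> inv b)"
      by (simp add: c_def)
    also have "\<dots> = a \<otimes> b \<otimes> b \<otimes> inv a \<otimes> inv b"
      using ab by (simp add: m_assoc inv_cancel_left)
    finally have "c \<otimes> b \<otimes> c = a \<otimes> b \<otimes> b \<otimes> inv a \<otimes> inv b" .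
    then show ?thesis using ab by (simp add: m_assoc inv_mult_group)
  qed
  have "commutator a (b \<otimes> b) \<otimes> (b \<otimes> c \<otimes> inv b) [^] m
      = c \<otimes> b \<otimes> c \<otimes> (inv b \<otimes> b) \<otimes> c [^] m \<otimes> inv b"
    unfolding 1 conj using ab c by (simp add: m_assoc inv_cancel_left)
  also have "\<dots> = c \<otimes> (b \<otimes> c [^] Suc m) \<otimes> inv b"
    unfolding nat_pow_Suc2[OF c] using ab c by (simp add: m_assoc inv_cancel_left)
  also have "\<dots> = c \<otimes> c [^] Suc m"
    unfolding central[folded c_def, symmetric] using ab c by (simp add: m_assoc)
  also have "\<dots> = c [^] Suc (Suc m)"
    using c by (metis nat_pow_Suc2)
  finally show ?thesis by (simp add: c_def)
qed

text \<open>A commutator depends only on the classes of its arguments modulo a central subgroup, so there are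
finitely many commutators. By Lagrange's theorem in the quotient a fixed power of each of them is
central, so the shortening of powers applies.\<close>

theorem finite_derived_if_central_subgroup_of_finite_index:
  assumes Z: "subgroup Z G" and fin: "finite (rcosets Z)"
    and central: "\<And>z x. z \<in> Z \<Longrightarrow> x \<in> carrier G \<Longrightarrow> z \<otimes> x = x \<otimes> z"
  shows "finite (derived G (carrier G))"
proof -
  define K where "K = derived_set G (carrier G)"
  have KI: "commutator a b \<in> K" if "a \<in> carrier G" "b \<in> carrier G" for a b
    using that by (auto simp: K_def)
  have KE: "\<exists>a b. a \<in> carrier G \<and> b \<in> carrier G \<and> x = commutator a b" if "x \<in> K" for x
    using that by (auto simp: K_def)
  have KG: "K \<subseteq> carrier G" unfolding K_def by (simp add: derived_set_in_carrier)
  have inv: "inv x \<in> K" if "x \<in> K" for x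
  proof -
    obtain a b where ab: "a \<in> carrier G" "b \<in> carrier G" "x = commutator a b"
      using KE \<open>x \<in> K\<close> by blast
    then have "inv x = commutator b a" by (simp add: inv_mult_group m_assoc)
    then show ?thesis using KI ab by simp
  qed
  have conj: "g \<otimes> x \<otimes> inv g \<in> K" if g: "g \<in> carrier G" and "x \<in> K" for g x
  proof -
    obtain a b where ab: "a \<in> carrier G" "b \<in> carrier G" "x = commutator a b"
      using KE \<open>x \<in> K\<close> by blast
    have "g \<otimes> x \<otimes> inv g = commutator (g \<otimes> a \<otimes> inv g) (g \<otimes> b \<otimes> inv g)"
      using eval_word_conj[OF g ab(1,2), of "Comm VarX VarY"] ab(3) by (simp add: Comm_def)
    then show ?thesis using KI ab g by simp
  qed
  interpret Z: subgroup Z G by fact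
  interpret Zn: normal Z G
    unfolding normal_inv_iff using Z central
    by (simp add: m_assoc[symmetric]) (metis Z.mem_carrier inv_closed m_assoc r_inv r_one)
  have finK: "finite K"
  proof -
    define r where "r = (\<lambda>A :: 'a set. SOME x. x \<in> A)"
    have shift: "\<exists>z\<in>Z. a = z \<otimes> r (Z #> a) \<and> r (Z #> a) \<in> carrier G" if a: "a \<in> carrier G" for a
    proof -
      have "r (Z #> a) \<in> Z #> a"
        unfolding r_def using rcos_self[OF a Z] by (rule someI)
      then obtain z where z: "z \<in> Z" "r (Z #> a) = z \<otimes> a" by (auto simp: r_coset_def)
      then have "a = inv z \<otimes> r (Z #> a)" using a by (simp add: m_assoc[symmetric])
      then show ?thesis using z a by (metis Z.m_inv_closed Z.mem_carrier m_closed)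
    qed
    have cancel: "commutator (z \<otimes> a) (z' \<otimes> b) = commutator a b"
      if "z \<in> Z" "z' \<in> Z" "a \<in> carrier G" "b \<in> carrier G" for z z' a b
    proof -
      have "commutator z z' = \<one>"
        using that central commutator_eq_one_iff Z.mem_carrier by metis
      then show ?thesis
        using eval_word_mult_commuting[OF Z subgroup_self central that, of "Comm VarX VarY"] that
        by (simp add: Comm_def)
    qed
    have "K \<subseteq> (\<lambda>(A, B). commutator (r A) (r B)) ` ((rcosets Z) \<times> (rcosets Z))"
    proof
      fix x assume "x \<in> K"
      then obtain a b where ab: "a \<in> carrier G" "b \<in> carrier G" "x = commutator a b"
        using KE by blast
      then have "x = commutator (r (Z #> a)) (r (Z #> b))"
        using shift[of a] shift[of b] cancel by metis
      then show "x \<in> (\<lambda>(A, B). commutator (r A) (r B)) ` ((rcosets Z) \<times> (rcosets Z))"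
        using ab by (intro image_eqI[of _ _ "(Z #> a, Z #> b)"]) (auto simp: rcosetsI Z.subset)
    qed
    then show ?thesis by (rule finite_surj[OF finite_cartesian_product[OF fin fin]])
  qed
  interpret Q: group "G Mod Z" by (rule Zn.factorgroup_is_group)
  have "finite (carrier (G Mod Z))" using fin by (simp add: FactGroup_def)
  then obtain m where m: "order (G Mod Z) = Suc m"
    using Q.order_gt_0_iff_finite gr0_implies_Suc by blast
  have pow: "x [^] Suc m \<in> Z" if x: "x \<in> carrier G" for x
  proof -
    have "Z #> (x [^] Suc m) = (Z #> x) [^]\<^bsub>G Mod Z\<^esub> Suc m"
      by (rule Zn.FactGroup_pow[OF x, symmetric])
    also have "\<dots> = Z"
      using Q.pow_order_eq_1[of "Z #> x"] x m by (simp add: carrier_FactGroup del: nat_pow_Suc)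
    finally show ?thesis using x Z coset_join1 nat_pow_closed by metis
  qed
  have "finite (generate G K)"
  proof (rule finite_generate_if_powers_shorten[OF KG finK inv conj, where m = "Suc m"])
    fix c assume "c \<in> K"
    then obtain a b where ab: "a \<in> carrier G" "b \<in> carrier G" "c = commutator a b"
      using KE by blast
    have c: "c \<in> carrier G" using ab by simp
    have "c [^] Suc (Suc m) = commutator a (b \<otimes> b) \<otimes> (b \<otimes> c \<otimes> inv b) [^] m"
      using commutator_power_shortens[OF ab(1,2), of m] central[OF pow[OF c] ab(2)] ab(3) by simp
    also have "\<dots> = product_of_list (commutator a (b \<otimes> b) # replicate m (b \<otimes> c \<otimes> inv b))"
      using ab c by (simp add: product_of_list_replicate del: foldr_replicate)
    finally show "\<exists>zs. set zs \<subseteq> K \<and> length zs = Suc m \<and> c [^] Suc (Suc m) = product_of_list zs"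
      using KI[OF ab(1), of "b \<otimes> b"] conj[OF ab(2) \<open>c \<in> K\<close>] ab
      by (intro exI[of _ "commutator a (b \<otimes> b) # replicate m (b \<otimes> c \<otimes> inv b)"]) auto
  qed
  then show ?thesis by (simp add: derived_def K_def)
qed

end

section \<open>Open normal subgroups of a profinite group\<close>

locale profinite = group G for G :: "('a, 'b) monoid_scheme" (structure) +
  fixes T :: "'a topology"
  assumes profinite: "profinite_group G T"
begin

lemma topspace_eq [simp]: "topspace T = carrier G"
  and compact: "compact_space T"
  and Hausdorff: "Hausdorff_space T"
  and component: "x \<in> carrier G \<Longrightarrow> connected_component_of_set T x = {x}"
  using profinite by (auto simp: profinite_group_def)

lemma continuous_map_mult:
  assumes "continuous_map X T f" "continuous_map X T g"
  shows "continuous_map X T (\<lambda>x. f x \<otimes> g x)"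
proof -
  have "continuous_map X T ((\<lambda>(x, y). x \<otimes> y) \<circ> (\<lambda>x. (f x, g x)))"
    using profinite assms unfolding profinite_group_def
    by (intro continuous_map_compose[of _ "prod_topology T T"]) (auto simp: continuous_map_paired)
  then show ?thesis by (simp add: o_def)
qed

definition open_normal :: "'a set \<Rightarrow> bool" where
  "open_normal N \<longleftrightarrow> N \<lhd> G \<and> openin T N"

lemma open_normal_normal: "open_normal N \<Longrightarrow> N \<lhd> G"
  and open_normal_subgroup: "open_normal N \<Longrightarrow> subgroup N G"
  by (auto simp: open_normal_def normal_imp_subgroup)

lemma open_normal_mem: "open_normal N \<Longrightarrow> x \<in> N \<Longrightarrow> x \<in> carrier G"
  using open_normal_subgroup subgroup.mem_carrier by metis

lemma open_normal_carrier: "open_normal (carrier G)"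
  using openin_topspace[of T] by (simp add: open_normal_def normal_inv_iff subgroup_self)

lemma open_normal_Int: "open_normal M \<Longrightarrow> open_normal N \<Longrightarrow> open_normal (M \<inter> N)"
  by (auto simp: open_normal_def normal_subgroup_intersect)

lemma r_coset_eq_vimage:
  assumes "N \<subseteq> carrier G" "x \<in> carrier G"
  shows "N #> x = {y \<in> topspace T. y \<otimes> inv x \<in> N}"
proof -
  have "y = y \<otimes> inv x \<otimes> x" if "y \<in> carrier G" for y
    using that assms by (simp add: m_assoc)
  then show ?thesis
    using assms by (force simp: r_coset_def m_assoc subset_iff)
qed

lemma continuous_map_translation: "x \<in> carrier G \<Longrightarrow> continuous_map T T (\<lambda>y. y \<otimes> x)"
  by (intro continuous_map_mult) auto

lemma openin_r_coset: "openin T N \<Longrightarrow> x \<in> carrier G \<Longrightarrow> openin T (N #> x)"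
  using openin_continuous_map_preimage[OF continuous_map_translation, of "inv x" N]
    r_coset_eq_vimage[of N x] openin_subset[of T N] by simp

lemma closedin_r_coset: "closedin T N \<Longrightarrow> x \<in> carrier G \<Longrightarrow> closedin T (N #> x)"
  using closedin_continuous_map_preimage[OF continuous_map_translation, of "inv x" N]
    r_coset_eq_vimage[of N x] closedin_subset[of T N] by simp

lemma closedin_open_subgroup:
  assumes N: "subgroup N G" "openin T N"
  shows "closedin T N"
proof -
  have "carrier G - N = (\<Union>x\<in>carrier G - N. N #> x)"
  proof
    show "carrier G - N \<subseteq> (\<Union>x\<in>carrier G - N. N #> x)"
      using rcos_self N by fast
    show "(\<Union>x\<in>carrier G - N. N #> x) \<subseteq> carrier G - N"
    proof safe
      fix x y assume x: "x \<in> carrier G" "x \<notin> N" and y: "y \<in> N #> x"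
      then show "y \<in> carrier G" using N r_coset_subset_G subgroup.subset by blast
      assume "y \<in> N"
      then have "N #> x = N"
        using repr_independence[OF y x(1) N(1)] coset_join2 N(1) subgroup.mem_carrier by metis
      then show False using rcos_self[OF x(1) N(1)] x by simp
    qed
  qed
  moreover have "openin T (\<Union>x\<in>carrier G - N. N #> x)"
    using N openin_r_coset by blast
  ultimately show ?thesis
    using subgroup.subset[OF N(1)] by (simp add: closedin_def)
qed

lemma finite_rcosets_open_subgroup:
  assumes N: "subgroup N G" "openin T N"
  shows "finite (rcosets N)"
proof -
  have "openin T U" if "U \<in> rcosets N" for U
    using that N openin_r_coset by (auto simp: RCOSETS_def)
  moreover have "topspace T \<subseteq> \<Union>(rcosets N)"
    by (simp add: rcosets_part_G[OF N(1)])
  ultimately obtain F where F: "finite F" "F \<subseteq> rcosets N" "carrier G \<subseteq> \<Union>F"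
    using compact[unfolded compact_space_alt, rule_format, of "rcosets N"] by auto
  have "rcosets N \<subseteq> F"
  proof
    fix U assume U: "U \<in> rcosets N"
    then obtain x where x: "x \<in> carrier G" "x \<in> U"
      using rcos_self N by (auto simp: RCOSETS_def)
    then obtain U' where "U' \<in> F" "x \<in> U'" using F by blast
    then have "U' = U"
      using x U F rcos_disjoint[OF N(1)] by (metis disjnt_iff pairwiseD subsetD)
    then show "U \<in> F" using \<open>U' \<in> F\<close> by simp
  qed
  then show ?thesis using F finite_subset by blast
qed

text \<open>The set \<open>N\<close> of all \<open>g\<close> whose insertion at any place of a product leaves membership in \<open>U\<close> unchanged is
a normal subgroup, by mere cancellation. It is open because its complement is a projection, along a
compact factor, of a closed set; and it lies in \<open>U\<close> because \<open>\<one>\<close> does.\<close>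

lemma open_normal_in_clopen:
  assumes U: "openin T U" "closedin T U" "\<one> \<in> U"
  shows "\<exists>N. open_normal N \<and> N \<subseteq> U"
proof -
  define N where "N = {g \<in> carrier G. \<forall>x\<in>carrier G. \<forall>y\<in>carrier G. x \<otimes> g \<otimes> y \<in> U \<longleftrightarrow> x \<otimes> y \<in> U}"
  have N: "x \<otimes> g \<otimes> y \<in> U \<longleftrightarrow> x \<otimes> y \<in> U"
    if "g \<in> N" "x \<in> carrier G" "y \<in> carrier G" for g x y
    using that by (simp add: N_def)
  have NI: "g \<in> N"
    if "g \<in> carrier G" "\<And>x y. x \<in> carrier G \<Longrightarrow> y \<in> carrier G \<Longrightarrow> x \<otimes> g \<otimes> y \<in> U \<longleftrightarrow> x \<otimes> y \<in> U" for g
    using that by (simp add: N_def)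
  have NG: "N \<subseteq> carrier G" by (auto simp: N_def)
  have "subgroup N G"
  proof (rule subgroupI)
    show "N \<noteq> {}" using NI[OF one_closed] by auto
  next
    fix g assume g: "g \<in> N"
    show "inv g \<in> N"
    proof (rule NI)
      fix x y assume xy: "x \<in> carrier G" "y \<in> carrier G"
      have "x \<otimes> inv g \<otimes> g \<otimes> y = x \<otimes> y" using g NG xy by (simp add: m_assoc subsetD)
      then show "x \<otimes> inv g \<otimes> y \<in> U \<longleftrightarrow> x \<otimes> y \<in> U"
        using N[OF g, of "x \<otimes> inv g" y] g NG xy by auto
    qed (use g NG in auto)
  next
    fix g g' assume g: "g \<in> N" "g' \<in> N"
    show "g \<otimes> g' \<in> N"
    proof (rule NI)
      fix x y assume xy: "x \<in> carrier G" "y \<in> carrier G"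
      have "x \<otimes> (g \<otimes> g') \<otimes> y = x \<otimes> g \<otimes> g' \<otimes> y" using g NG xy by (simp add: m_assoc subsetD)
      moreover have "x \<otimes> g \<otimes> g' \<otimes> y \<in> U \<longleftrightarrow> x \<otimes> g \<otimes> y \<in> U"
        using N[OF g(2), of "x \<otimes> g" y] g NG xy by auto
      ultimately show "x \<otimes> (g \<otimes> g') \<otimes> y \<in> U \<longleftrightarrow> x \<otimes> y \<in> U"
        using N[OF g(1) xy] by simp
    qed (use g NG in auto)
  qed (rule NG)
  moreover have "z \<otimes> g \<otimes> inv z \<in> N" if g: "g \<in> N" and z: "z \<in> carrier G" for g z
  proof (rule NI)
    have gG: "g \<in> carrier G" using g NG by auto
    fix x y assume xy: "x \<in> carrier G" "y \<in> carrier G"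
    have "x \<otimes> (z \<otimes> g \<otimes> inv z) \<otimes> y = (x \<otimes> z) \<otimes> g \<otimes> (inv z \<otimes> y)"
      using gG z xy by (simp add: m_assoc)
    moreover have "x \<otimes> y = (x \<otimes> z) \<otimes> (inv z \<otimes> y)"
      using z xy by (metis inv_closed inv_solve_left m_assoc m_closed)
    ultimately show "x \<otimes> (z \<otimes> g \<otimes> inv z) \<otimes> y \<in> U \<longleftrightarrow> x \<otimes> y \<in> U"
      using N[OF g, of "x \<otimes> z" "inv z \<otimes> y"] z xy by simp
  qed (use g z NG in auto)
  ultimately have "N \<lhd> G" by (simp add: normal_inv_iff)
  moreover have "openin T N"
  proof -
    let ?X = "prod_topology T (prod_topology T T)"
    let ?p = "\<lambda>t. fst (snd t) \<otimes> fst t \<otimes> snd (snd t)" and ?q = "\<lambda>t. fst (snd t) \<otimes> snd (snd t)"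
    have c: "continuous_map ?X T fst" "continuous_map ?X T (\<lambda>t. fst (snd t))" "continuous_map ?X T (\<lambda>t. snd (snd t))"
      using continuous_map_compose[OF continuous_map_snd continuous_map_fst, of T T T]
        continuous_map_compose[OF continuous_map_snd continuous_map_snd, of T T T]
      by (auto simp: continuous_map_fst o_def)
    have p: "continuous_map ?X T ?p" and q: "continuous_map ?X T ?q"
      by (intro continuous_map_mult c)+
    have Uc: "closedin T (carrier G - U)" using U(1) by (simp add: openin_closedin_eq)
    define B where "B = ({t \<in> topspace ?X. ?p t \<in> U} \<inter> {t \<in> topspace ?X. ?q t \<in> carrier G - U})
       \<union> ({t \<in> topspace ?X. ?p t \<in> carrier G - U} \<inter> {t \<in> topspace ?X. ?q t \<in> U})"
    have "closedin ?X B"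
      unfolding B_def by (intro closedin_Un closedin_Int closedin_continuous_map_preimage[OF p]
          closedin_continuous_map_preimage[OF q] U Uc)
    moreover have "closed_map ?X T fst"
      by (intro closed_map_fst) (simp add: compact compact_space_prod_topology)
    ultimately have "closedin T (fst ` B)" by (simp add: closed_map_def)
    moreover have "N = carrier G - fst ` B"
    proof -
      have "(g, x, y) \<in> B \<longleftrightarrow> g \<in> carrier G \<and> x \<in> carrier G \<and> y \<in> carrier G
          \<and> (x \<otimes> g \<otimes> y \<in> U) \<noteq> (x \<otimes> y \<in> U)" for g x y
        by (auto simp: B_def)
      moreover have "g \<in> fst ` B \<longleftrightarrow> (\<exists>x y. (g, x, y) \<in> B)" for g
        by force
      ultimately have "g \<in> fst ` B \<longleftrightarrow> g \<in> carrier G \<and> \<not> g \<in> N" for g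
        by (auto simp: N_def)
      then show ?thesis using NG by auto
    qed
    ultimately show ?thesis by (simp add: closedin_def)
  qed
  moreover have "N \<subseteq> U"
  proof
    fix g assume "g \<in> N"
    then show "g \<in> U" using N[of g \<one> \<one>] NG U(3) by auto
  qed
  ultimately show ?thesis by (auto simp: open_normal_def)
qed

text \<open>In a compact Hausdorff space connected components and quasi-components agree, so total
disconnectedness yields clopen sets that separate points.\<close>

lemma open_normal_separates:
  assumes "g \<in> carrier G" "g \<noteq> \<one>"
  shows "\<exists>N. open_normal N \<and> g \<notin> N"
proof -
  have "quasi_component_of T \<one> = connected_component_of T \<one>"
    using compact Hausdorff by (intro quasi_eq_connected_component_of) auto
  then have "\<not> quasi_component_of T \<one> g"
    using component[OF one_closed] assms by auto
  then obtain U where "openin T U" "closedin T U" "\<one> \<in> U" "g \<notin> U"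
    using assms by (auto simp: quasi_component_of)
  then show ?thesis using open_normal_in_clopen by blast
qed

lemma nested_cosets_meet:
  assumes C: "\<And>n. open_normal (C n)" and dec: "\<And>n. C (Suc n) \<subseteq> C n"
    and p: "\<And>n. p n \<in> carrier G" "\<And>n. C n #> p (Suc n) = C n #> p n"
  shows "\<exists>x\<in>carrier G. \<forall>n. C n #> x = C n #> p n"
proof -
  have sub: "subgroup (C n) G" for n using C open_normal_subgroup by blast
  have "(\<Inter>n. C n #> p n) \<noteq> {}"
  proof (rule compact_space_imp_nest[OF compact])
    show "closedin T (C n #> p n)" for n
      using C p closedin_open_subgroup closedin_r_coset by (simp add: open_normal_def normal_imp_subgroup)
    show "C n #> p n \<noteq> {}" for n using rcos_self[OF p(1) sub] by blast
    show "decseq (\<lambda>n. C n #> p n)"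
    proof (rule decseq_SucI)
      fix n
      have "C (Suc n) #> p (Suc n) \<subseteq> C n #> p (Suc n)" using dec by (auto simp: r_coset_def)
      then show "C (Suc n) #> p (Suc n) \<le> C n #> p n" using p(2) by simp
    qed
  qed
  then obtain x where x: "\<And>n. x \<in> C n #> p n" by blast
  then show ?thesis
    using repr_independence[OF x p(1) sub] r_coset_subset_G[OF subgroup.subset[OF sub] p(1)] by blast
qed

lemma same_coset_iff:
  assumes "subgroup N G" "a \<in> carrier G" "b \<in> carrier G"
  shows "N #> a = N #> b \<longleftrightarrow> a \<otimes> inv b \<in> N"
proof -
  have "N #> a = N #> b \<longleftrightarrow> a \<in> N #> b"
    using assms by (metis repr_independence rcos_self)
  then show ?thesis
    using assms r_coset_eq_vimage[of N b] by (simp add: subgroup.subset)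
qed

section \<open>Constructing continuum many values\<close>

text \<open>The reason why few values force triviality. For each set \<open>I\<close> of indices, compactness provides infinite
products \<open>X I\<close> and \<open>Y I\<close> of the \<open>x i\<close> and of the \<open>y i\<close> over \<open>i \<in> I\<close>, in the sense
that modulo each \<open>C n\<close> they agree with the products over \<open>i < n\<close>. If \<open>n\<close> is the first place where
\<open>I\<close> and \<open>J\<close> differ, the values at \<open>(X I, Y I)\<close> and \<open>(X J, Y J)\<close> are told apart modulo
\<open>C (Suc n)\<close> by the hypothesis on \<open>f\<close>, so that the \<open>f (X I) (Y I)\<close> are pairwise distinct. The sets
\<open>P n\<close> record a property of the finite partial products that is available when this hypothesis has to be
verified.\<close>

lemma continuum_many_values:
  fixes C P :: "nat \<Rightarrow> 'a set" and x y :: "nat \<Rightarrow> 'a" and f :: "'a \<Rightarrow> 'a \<Rightarrow> 'a"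
  assumes C: "\<And>n. open_normal (C n)" and dec: "\<And>n. C (Suc n) \<subseteq> C n"
    and xy: "\<And>n. x n \<in> C n" "\<And>n. y n \<in> C n"
    and P: "\<one> \<in> P 0" "\<And>n p. p \<in> P n \<Longrightarrow> p \<in> P (Suc n)"
      "\<And>n p. p \<in> P n \<Longrightarrow> p \<otimes> x n \<in> P (Suc n)" "\<And>n p. p \<in> P n \<Longrightarrow> p \<otimes> y n \<in> P (Suc n)"
    and cong: "\<And>N a b a' b'. \<lbrakk>N \<lhd> G; a \<in> carrier G; b \<in> carrier G; a' \<in> carrier G; b' \<in> carrier G;
      N #> a = N #> a'; N #> b = N #> b'\<rbrakk> \<Longrightarrow> N #> f a b = N #> f a' b'"
    and sep: "\<And>n p q. \<lbrakk>p \<in> carrier G; q \<in> carrier G; p \<in> P n; q \<in> P n\<rbrakk> \<Longrightarrow>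
      C (Suc n) #> f (p \<otimes> x n) (q \<otimes> y n) \<noteq> C (Suc n) #> f p q"
  shows "(UNIV :: nat set set) \<lesssim> {f a b | a b. a \<in> C 0 \<and> b \<in> C 0}"
proof -
  have sub: "subgroup (C n) G" for n using C open_normal_subgroup by blast
  have CG: "C n \<subseteq> carrier G" for n using sub subgroup.subset by blast
  have C0: "C n \<subseteq> C 0" for n
    using lift_Suc_antimono_le[of C 0 n] dec by simp
  \<comment> \<open>\<open>pp z I n\<close> is the product of the \<open>z i\<close> over \<open>i \<in> I\<close>, \<open>i < n\<close>.\<close>
  define pp where "pp = (\<lambda>z I. rec_nat \<one> (\<lambda>n p. if n \<in> I then p \<otimes> z n else p))"
  have pp0: "pp z I 0 = \<one>"
    and ppS: "pp z I (Suc n) = (if n \<in> I then pp z I n \<otimes> z n else pp z I n)" for z I n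
    by (simp_all add: pp_def)
  have ppC0: "pp z I n \<in> C 0" if z: "\<And>n. z n \<in> C n" for z I n
    by (induction n) (use C0 z sub in \<open>auto simp: pp0 ppS subgroup.one_closed intro!: subgroup.m_closed\<close>)
  have lim: "\<exists>a\<in>C 0. \<forall>n. C n #> a = C n #> pp z I n" if z: "\<And>n. z n \<in> C n" for z I
  proof -
    have G: "pp z I n \<in> carrier G" for n using ppC0[OF z] CG by blast
    have "C n #> pp z I (Suc n) = C n #> pp z I n" for n
    proof -
      have "C n #> (pp z I n \<otimes> z n) = C n #> pp z I n"
        using normal.inv_op_closed2[OF open_normal_normal[OF C] G z] G[of n] z[of n] subsetD[OF CG z[of n]]
        by (subst same_coset_iff[OF sub]) auto
      then show ?thesis by (simp add: ppS)
    qed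
    then obtain a where a: "a \<in> carrier G" "\<And>n. C n #> a = C n #> pp z I n"
      using nested_cosets_meet[of C "pp z I"] C dec G by blast
    then have "C 0 #> a = C 0" using a(2)[of 0] CG by (simp add: pp0)
    then show ?thesis using a coset_join1[OF _ a(1) sub] by blast
  qed
  obtain X where X: "\<And>I. X I \<in> C 0" "\<And>I n. C n #> X I = C n #> pp x I n"
    using lim[OF xy(1)] by metis
  obtain Y where Y: "\<And>I. Y I \<in> C 0" "\<And>I n. C n #> Y I = C n #> pp y I n"
    using lim[OF xy(2)] by metis
  have ppP: "pp x I n \<in> P n" "pp y I n \<in> P n" for I n
    by (induction n) (auto simp: pp0 ppS P)
  have approx: "C n #> f (X I) (Y I) = C n #> f (pp x I n) (pp y I n)" for I n
  proof (rule cong[OF open_normal_normal[OF C] _ _ _ _ X(2) Y(2)])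
    show "X I \<in> carrier G" "Y I \<in> carrier G" using X(1) Y(1) CG by blast+
    show "pp x I n \<in> carrier G" "pp y I n \<in> carrier G"
      using ppC0[of x] ppC0[of y] xy CG by blast+
  qed
  have agree: "pp z I n = pp z J n" if "\<And>i. i < n \<Longrightarrow> i \<in> I \<longleftrightarrow> i \<in> J" for z I J n
    using that by (induction n) (auto simp: pp0 ppS)
  have neq: "f (X I) (Y I) \<noteq> f (X J) (Y J)"
    if "n \<in> I" "n \<notin> J" "\<And>i. i < n \<Longrightarrow> i \<in> I \<longleftrightarrow> i \<in> J" for I J n
  proof
    assume "f (X I) (Y I) = f (X J) (Y J)"
    then have "C (Suc n) #> f (pp x I (Suc n)) (pp y I (Suc n)) = C (Suc n) #> f (pp x J (Suc n)) (pp y J (Suc n))"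
      using approx by metis
    then have "C (Suc n) #> f (pp x I n \<otimes> x n) (pp y I n \<otimes> y n) = C (Suc n) #> f (pp x I n) (pp y I n)"
      using that agree[of n I J] by (simp add: ppS)
    then show False
      using sep[of "pp x I n" "pp y I n" n] ppP ppC0[OF xy(1)] ppC0[OF xy(2)] CG by blast
  qed
  have "inj (\<lambda>I. f (X I) (Y I))"
  proof (rule injI, rule ccontr)
    fix I J assume eq: "f (X I) (Y I) = f (X J) (Y J)" and "I \<noteq> J"
    then have ex: "\<exists>n. (n \<in> I) \<noteq> (n \<in> J)" by auto
    define n where "n = (LEAST n. (n \<in> I) \<noteq> (n \<in> J))"
    have "(n \<in> I) \<noteq> (n \<in> J)" and "\<And>i. i < n \<Longrightarrow> i \<in> I \<longleftrightarrow> i \<in> J"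
      using LeastI_ex[OF ex] not_less_Least unfolding n_def by blast+
    then show False using neq[of n I J] neq[of n J I] eq by auto
  qed
  then show ?thesis
    using X Y unfolding lepoll_def by blast
qed

section \<open>Elements with open centralizer\<close>

text \<open>The profinite analogue of the FC-centre: the elements whose centralizer is open, equivalently whose
conjugacy class is finite.\<close>

definition FC :: "'a set" where
  "FC = {g \<in> carrier G. \<exists>N. open_normal N \<and> (\<forall>x\<in>N. x \<otimes> g = g \<otimes> x)}"

text \<open>If the centralizer of \<open>g\<close> were not open, each open normal subgroup would contain some \<open>x\<close> with
\<open>[x, g] \<noteq> \<one>\<close>. Choose such \<open>x n\<close> in shrinking subgroups \<open>C n\<close>, the next one small enough to miss
\<open>[x n, g]\<close>; the products of the \<open>x n\<close> then give continuum many conjugates of \<open>g\<close>.\<close>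

lemma FC_if_few_conjugates:
  assumes V: "open_normal V" and g: "g \<in> carrier G"
    and few: "{x \<otimes> g \<otimes> inv x | x. x \<in> V} \<prec> (UNIV :: nat set set)"
  shows "g \<in> FC"
proof (rule ccontr)
  assume "g \<notin> FC"
  then have nc: "\<exists>x\<in>N. x \<otimes> g \<noteq> g \<otimes> x" if "open_normal N" for N
    using that g by (auto simp: FC_def)
  define ok where "ok = (\<lambda>(C, x). open_normal C \<and> C \<subseteq> V \<and> x \<in> C \<and> x \<otimes> g \<noteq> g \<otimes> x)"
  have "\<exists>s. \<forall>n. ok (s n) \<and> fst (s (Suc n)) \<subseteq> fst (s n) \<and> commutator (snd (s n)) g \<notin> fst (s (Suc n))"
  proof (rule dependent_nat_choice)
    show "\<exists>s. ok s" using V nc[OF V] by (auto simp: ok_def)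
  next
    fix s n assume "ok s"
    then obtain C x where s: "s = (C, x)" "open_normal C" "C \<subseteq> V" "x \<in> C" "x \<otimes> g \<noteq> g \<otimes> x"
      by (cases s) (auto simp: ok_def)
    have x: "x \<in> carrier G" using s open_normal_mem by blast
    then obtain D where D: "open_normal D" "commutator x g \<notin> D"
      using s g commutator_eq_one_iff[OF x g] open_normal_separates[of "commutator x g"] by auto
    have CD: "open_normal (C \<inter> D)" using s D open_normal_Int by blast
    then obtain x' where "x' \<in> C \<inter> D" "x' \<otimes> g \<noteq> g \<otimes> x'" using nc by blast
    then show "\<exists>s'. ok s' \<and> fst s' \<subseteq> fst s \<and> commutator (snd s) g \<notin> fst s'"
      using s D CD by (intro exI[of _ "(C \<inter> D, x')"]) (auto simp: ok_def)
  qed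
  then obtain s where s: "\<And>n. ok (s n)" "\<And>n. fst (s (Suc n)) \<subseteq> fst (s n)"
    "\<And>n. commutator (snd (s n)) g \<notin> fst (s (Suc n))" by blast
  define C where "C = (\<lambda>n. fst (s n))"
  define x where "x = (\<lambda>n. snd (s n))"
  have C: "\<And>n. open_normal (C n)" "C 0 \<subseteq> V" "\<And>n. C (Suc n) \<subseteq> C n" and x: "\<And>n. x n \<in> C n"
    and comm: "\<And>n. commutator (x n) g \<notin> C (Suc n)"
    using s by (auto simp: C_def x_def ok_def split_beta)
  have xG: "x n \<in> carrier G" for n using C x open_normal_mem by blast
  have "(UNIV :: nat set set) \<lesssim> {(\<lambda>a b. a \<otimes> g \<otimes> inv a) a b | a b. a \<in> C 0 \<and> b \<in> C 0}"
  proof (rule continuum_many_values[where C = C and x = x and y = x and P = "\<lambda>_. UNIV", OF C(1,3) x x])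
    fix N a b a' b' assume N: "N \<lhd> G" and a: "a \<in> carrier G" "a' \<in> carrier G" "N #> a = N #> a'"
    show "N #> (a \<otimes> g \<otimes> inv a) = N #> (a' \<otimes> g \<otimes> inv a')"
      using normal.eval_word_cong_cosets[OF N a(1) g a(2) g a(3) refl, of "Mult (Mult VarX VarY) (Inv VarX)"]
      by simp
  next
    fix n p q assume p: "p \<in> carrier G"
    interpret D: normal "C (Suc n)" G using C open_normal_normal by blast
    show "C (Suc n) #> (p \<otimes> x n \<otimes> g \<otimes> inv (p \<otimes> x n)) \<noteq> C (Suc n) #> (p \<otimes> g \<otimes> inv p)"
    proof
      assume eq: "C (Suc n) #> (p \<otimes> x n \<otimes> g \<otimes> inv (p \<otimes> x n)) = C (Suc n) #> (p \<otimes> g \<otimes> inv p)"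
      have "p \<otimes> x n \<otimes> g \<otimes> inv (p \<otimes> x n) \<otimes> inv (p \<otimes> g \<otimes> inv p) = p \<otimes> commutator (x n) g \<otimes> inv p"
        using p xG[of n] g by (simp add: inv_mult_group m_assoc) (metis inv_closed l_inv l_one m_assoc m_closed)
      then have "p \<otimes> commutator (x n) g \<otimes> inv p \<in> C (Suc n)"
        using eq p xG[of n] g by (subst (asm) same_coset_iff[OF D.subgroup_axioms]) auto
      then have "inv p \<otimes> (p \<otimes> commutator (x n) g \<otimes> inv p) \<otimes> p \<in> C (Suc n)"
        using D.inv_op_closed1 p by blast
      moreover have "inv p \<otimes> (p \<otimes> commutator (x n) g \<otimes> inv p) \<otimes> p = commutator (x n) g"
        using p xG[of n] g by (simp add: m_assoc) (metis inv_closed l_inv l_one m_assoc m_closed)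
      ultimately show False using comm by simp
    qed
  qed auto
  also have "{(\<lambda>a b. a \<otimes> g \<otimes> inv a) a b | a b. a \<in> C 0 \<and> b \<in> C 0} \<lesssim> {x \<otimes> g \<otimes> inv x | x. x \<in> V}"
    using C(2) by (intro subset_imp_lepoll) blast
  finally show False
    using few lesspoll_trans2 by blast
qed

lemma FC_subgroup: "subgroup FC G"
proof (rule subgroupI)
  have "\<one> \<in> FC" using open_normal_carrier by (auto simp: FC_def intro!: exI[of _ "carrier G"])
  then show "FC \<noteq> {}" by blast
next
  fix a assume "a \<in> FC"
  then obtain N where N: "open_normal N" "\<And>x. x \<in> N \<Longrightarrow> x \<otimes> a = a \<otimes> x" and a: "a \<in> carrier G"
    by (auto simp: FC_def)
  have "x \<otimes> inv a = inv a \<otimes> x" if "x \<in> N" for x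
    using inv_commute[OF a open_normal_mem[OF N(1) that]] N(2)[OF that] by simp
  then show "inv a \<in> FC" using N a by (auto simp: FC_def)
next
  fix a b assume "a \<in> FC" "b \<in> FC"
  then obtain M N where N: "open_normal M" "open_normal N"
    "\<And>x. x \<in> M \<Longrightarrow> x \<otimes> a = a \<otimes> x" "\<And>x. x \<in> N \<Longrightarrow> x \<otimes> b = b \<otimes> x"
    and ab: "a \<in> carrier G" "b \<in> carrier G"
    by (auto simp: FC_def)
  have "x \<otimes> (a \<otimes> b) = a \<otimes> b \<otimes> x" if "x \<in> M \<inter> N" for x
    using N that ab open_normal_mem by (metis IntD1 IntD2 m_assoc)
  then show "a \<otimes> b \<in> FC" using N ab open_normal_Int[of M N] unfolding FC_def by blast
qed (auto simp: FC_def)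

lemma FC_normal: "FC \<lhd> G"
  unfolding normal_inv_iff
proof (intro conjI ballI)
  fix z g assume z: "z \<in> carrier G" and "g \<in> FC"
  then obtain N where N: "open_normal N" "\<And>x. x \<in> N \<Longrightarrow> x \<otimes> g = g \<otimes> x" and g: "g \<in> carrier G"
    by (auto simp: FC_def)
  interpret N: normal N G using N open_normal_normal by blast
  have "x \<otimes> (z \<otimes> g \<otimes> inv z) = z \<otimes> g \<otimes> inv z \<otimes> x" if x: "x \<in> N" for x
  proof -
    have xG: "x \<in> carrier G" using x by simp
    have "x \<otimes> (z \<otimes> g \<otimes> inv z) = z \<otimes> ((inv z \<otimes> x \<otimes> z) \<otimes> g) \<otimes> inv z"
      using xG z g by (simp add: m_assoc[symmetric])
    also have "\<dots> = z \<otimes> (g \<otimes> (inv z \<otimes> x \<otimes> z)) \<otimes> inv z"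
      using N(2) N.inv_op_closed1[OF z x] by simp
    also have "\<dots> = z \<otimes> g \<otimes> inv z \<otimes> x"
      using xG z g by (simp add: m_assoc)
    finally show ?thesis .
  qed
  then show "z \<otimes> g \<otimes> inv z \<in> FC" using N z g by (auto simp: FC_def)
qed (rule FC_subgroup)

text \<open>Conjugates of values are values, so they too are few.\<close>

lemma word_values_in_FC:
  assumes few: "word_values w G \<prec> (UNIV :: nat set set)"
    and "a \<in> carrier G" "b \<in> carrier G"
  shows "eval_word G a b w \<in> FC"
proof (rule FC_if_few_conjugates[OF open_normal_carrier])
  have "{x \<otimes> eval_word G a b w \<otimes> inv x | x. x \<in> carrier G} \<subseteq> word_values w G"
    using assms(2,3) by (fastforce simp: word_values_def eval_word_conj)
  then show "{x \<otimes> eval_word G a b w \<otimes> inv x | x. x \<in> carrier G} \<prec> (UNIV :: nat set set)"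
    using few by (meson lesspoll_trans1 subset_imp_lepoll)
qed (use assms in auto)

text \<open>Otherwise each open normal subgroup contains \<open>a\<close>, \<open>b\<close> in \<open>FC\<close> with \<open>w(a,b) \<noteq> \<one>\<close>. Since \<open>a\<close> and
\<open>b\<close> have open centralizers, the next pair can be chosen in a subgroup that centralizes all the previous
ones. Values at products of such pairs are products of values, and so there are continuum many.\<close>

lemma word_law_on_FC_near_one:
  assumes few: "word_values w G \<prec> (UNIV :: nat set set)"
  shows "\<exists>C. open_normal C \<and> (\<forall>a\<in>FC \<inter> C. \<forall>b\<in>FC \<inter> C. eval_word G a b w = \<one>)"
proof (rule ccontr)
  assume "\<not> ?thesis"
  then have nt: "\<exists>a\<in>FC \<inter> C. \<exists>b\<in>FC \<inter> C. eval_word G a b w \<noteq> \<one>" if "open_normal C" for C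
    using that by blast
  define ok where "ok = (\<lambda>(C, a, b). open_normal C \<and> a \<in> FC \<inter> C \<and> b \<in> FC \<inter> C \<and> eval_word G a b w \<noteq> \<one>)"
  \<comment> \<open>The next subgroup misses the current value and centralizes the current pair.\<close>
  define succ where "succ = (\<lambda>(C, a, b) (D, _ :: 'a \<times> 'a). D \<subseteq> C \<and> eval_word G a b w \<notin> D
     \<and> (\<forall>z\<in>D. z \<otimes> a = a \<otimes> z \<and> z \<otimes> b = b \<otimes> z))"
  have "\<exists>s. \<forall>n. ok (s n) \<and> succ (s n) (s (Suc n))"
  proof (rule dependent_nat_choice)
    show "\<exists>s. ok s" using nt[OF open_normal_carrier] open_normal_carrier by (auto simp: ok_def)
  next
    fix s n assume "ok s"
    then obtain C a b where s: "s = (C, a, b)" "open_normal C" "a \<in> FC \<inter> C" "b \<in> FC \<inter> C" "eval_word G a b w \<noteq> \<one>"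
      by (cases s) (auto simp: ok_def)
    then obtain D where D: "open_normal D" "eval_word G a b w \<notin> D"
      using open_normal_separates[of "eval_word G a b w"] by (auto simp: FC_def)
    obtain A B where AB: "open_normal A" "\<And>z. z \<in> A \<Longrightarrow> z \<otimes> a = a \<otimes> z"
       "open_normal B" "\<And>z. z \<in> B \<Longrightarrow> z \<otimes> b = b \<otimes> z"
      using s by (auto simp: FC_def)
    define E where "E = C \<inter> D \<inter> (A \<inter> B)"
    have E: "open_normal E" unfolding E_def using s D AB by (intro open_normal_Int)
    then obtain a' b' where "a' \<in> FC \<inter> E" "b' \<in> FC \<inter> E" "eval_word G a' b' w \<noteq> \<one>" using nt by blast
    then have "ok (E, a', b')" "succ s (E, a', b')"
      using s D AB E by (auto simp: ok_def succ_def E_def)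
    then show "\<exists>s'. ok s' \<and> succ s s'" by blast
  qed
  then obtain s where s: "\<And>n. ok (s n)" "\<And>n. succ (s n) (s (Suc n))" by blast
  define C where "C = (\<lambda>n. fst (s n))"
  define x where "x = (\<lambda>n. fst (snd (s n)))"
  define y where "y = (\<lambda>n. snd (snd (s n)))"
  have C: "\<And>n. open_normal (C n)" "\<And>n. C (Suc n) \<subseteq> C n" and x: "\<And>n. x n \<in> C n" and y: "\<And>n. y n \<in> C n"
    and val: "\<And>n. eval_word G (x n) (y n) w \<notin> C (Suc n)"
    and comm: "\<And>n z. z \<in> C (Suc n) \<Longrightarrow> z \<otimes> x n = x n \<otimes> z \<and> z \<otimes> y n = y n \<otimes> z"
    using s by (auto simp: C_def x_def y_def ok_def succ_def split_beta)
  have sub: "subgroup (C n) G" for n using C open_normal_subgroup by blast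
  have CG: "z \<in> carrier G" if "z \<in> C n" for z n using that C(1) open_normal_mem by blast
  define P where "P = (\<lambda>n. {p \<in> carrier G. \<forall>z\<in>C n. p \<otimes> z = z \<otimes> p})"
  have P: "subgroup (P n) G" for n
  proof (rule subgroupI)
    show "P n \<noteq> {}" using CG by (auto simp: P_def)
  next
    fix a assume "a \<in> P n"
    then show "inv a \<in> P n" using CG inv_commute by (auto simp: P_def)
  next
    fix a b assume "a \<in> P n" "b \<in> P n"
    then show "a \<otimes> b \<in> P n" using CG unfolding P_def by (simp add: m_assoc) (metis m_assoc)
  qed (auto simp: P_def)
  have Pmono: "P n \<subseteq> P (Suc n)" for n using C(2) by (auto simp: P_def)
  have Pxy: "x n \<in> P (Suc n)" "y n \<in> P (Suc n)" for n
    using comm CG[OF x[of n]] CG[OF y[of n]] by (auto simp: P_def)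
  have "(UNIV :: nat set set) \<lesssim> {eval_word G a b w | a b. a \<in> C 0 \<and> b \<in> C 0}"
  proof (rule continuum_many_values[where C = C and x = x and y = y and P = P, OF C x y])
    show "\<one> \<in> P 0" by (rule subgroup.one_closed[OF P])
  next
    fix N a b a' b'
    assume "N \<lhd> G" "a \<in> carrier G" "b \<in> carrier G" "a' \<in> carrier G" "b' \<in> carrier G"
      "N #> a = N #> a'" "N #> b = N #> b'"
    then show "N #> eval_word G a b w = N #> eval_word G a' b' w"
      by (rule normal.eval_word_cong_cosets)
  next
    fix n p q assume pq: "p \<in> carrier G" "q \<in> carrier G" "p \<in> P n" "q \<in> P n"
    let ?u = "eval_word G p q w" and ?v = "eval_word G (x n) (y n) w"
    have u: "?u \<in> P n" and v: "?v \<in> C n"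
      using eval_word_in_subgroup P sub pq x y by blast+
    have "eval_word G (p \<otimes> x n) (q \<otimes> y n) w = ?u \<otimes> ?v"
      using pq x y by (intro eval_word_mult_commuting[OF P sub]) (auto simp: P_def)
    also have "\<dots> = ?v \<otimes> ?u" using u v by (auto simp: P_def)
    finally have "eval_word G (p \<otimes> x n) (q \<otimes> y n) w \<otimes> inv ?u = ?v"
      using pq CG[OF v] by (simp add: m_assoc)
    then show "C (Suc n) #> eval_word G (p \<otimes> x n) (q \<otimes> y n) w \<noteq> C (Suc n) #> ?u"
      using val[of n] pq CG[OF x[of n]] CG[OF y[of n]] by (subst same_coset_iff[OF sub]) auto
  next
    fix n p assume p: "p \<in> P n"
    then show "p \<in> P (Suc n)" using Pmono by blast
    then show "p \<otimes> x n \<in> P (Suc n)" "p \<otimes> y n \<in> P (Suc n)"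
      using Pxy subgroup.m_closed[OF P] by auto
  qed
  also have "{eval_word G a b w | a b. a \<in> C 0 \<and> b \<in> C 0} \<lesssim> word_values w G"
    using CG by (intro subset_imp_lepoll) (auto simp: word_values_def)
  finally show False
    using few lesspoll_trans2 by blast
qed

section \<open>From few values to a finite derived subgroup\<close>

lemma openin_normal_set_mult:
  assumes "openin T N" "S \<subseteq> carrier G"
  shows "openin T (N <#> S)"
proof -
  have "N <#> S = (\<Union>s\<in>S. N #> s)" by (auto simp: set_mult_def r_coset_def)
  moreover have "openin T (N #> s)" if "s \<in> S" for s
    using that assms openin_r_coset by blast
  ultimately show ?thesis by auto
qed

lemma open_normal_centralizing_finite_set:
  assumes "finite A" "A \<subseteq> FC"
  shows "\<exists>N. open_normal N \<and> (\<forall>x\<in>N. \<forall>a\<in>A. x \<otimes> a = a \<otimes> x)"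
  using assms
proof (induction A)
  case empty
  then show ?case using open_normal_carrier by auto
next
  case (insert a A)
  then obtain M N where "open_normal M" "\<forall>x\<in>M. \<forall>a\<in>A. x \<otimes> a = a \<otimes> x"
    "open_normal N" "\<forall>x\<in>N. x \<otimes> a = a \<otimes> x"
    by (auto simp: FC_def)
  then show ?case by (intro exI[of _ "M \<inter> N"]) (auto intro: open_normal_Int)
qed

text \<open>\<open>G\<close> is generated by \<open>C\<close> and a finite set of coset representatives. An open normal subgroup of \<open>C\<close>
that centralizes these representatives is central of finite index, and Schur's theorem applies.\<close>

lemma finite_derived_if_abelian_open_normal_and_FC:
  assumes C: "open_normal C" and abelian: "\<And>a b. a \<in> C \<Longrightarrow> b \<in> C \<Longrightarrow> a \<otimes> b = b \<otimes> a"
    and FC: "FC = carrier G"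
  shows "finite (derived G (carrier G))"
proof -
  have sub: "subgroup C G" using C open_normal_subgroup by blast
  define r where "r = (\<lambda>A :: 'a set. SOME x. x \<in> A)"
  have r: "r (C #> x) \<in> C #> x" if "x \<in> carrier G" for x
    unfolding r_def using rcos_self[OF that sub] by (rule someI)
  have "finite (r ` (rcosets C))"
    using C finite_rcosets_open_subgroup by (simp add: open_normal_def normal_imp_subgroup)
  moreover have "r ` (rcosets C) \<subseteq> FC"
  proof
    fix y assume "y \<in> r ` (rcosets C)"
    then obtain x where "x \<in> carrier G" "y = r (C #> x)" by (auto simp: RCOSETS_def)
    then show "y \<in> FC"
      using r[of x] r_coset_subset_G[OF subgroup.subset[OF sub], of x] by (auto simp: FC)
  qed
  ultimately have "\<exists>N. open_normal N \<and> (\<forall>x\<in>N. \<forall>a\<in>r ` (rcosets C). x \<otimes> a = a \<otimes> x)"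
    by (rule open_normal_centralizing_finite_set)
  then obtain N where N: "open_normal N" "\<And>x a. x \<in> N \<Longrightarrow> a \<in> r ` (rcosets C) \<Longrightarrow> x \<otimes> a = a \<otimes> x"
    by blast
  have Z: "open_normal (C \<inter> N)" using C N open_normal_Int by blast
  show ?thesis
  proof (rule finite_derived_if_central_subgroup_of_finite_index)
    show "subgroup (C \<inter> N) G" using Z open_normal_subgroup by blast
    show "finite (rcosets (C \<inter> N))"
      using Z finite_rcosets_open_subgroup by (simp add: open_normal_def normal_imp_subgroup)
    fix z x assume z: "z \<in> C \<inter> N" and x: "x \<in> carrier G"
    define t where "t = r (C #> x)"
    have tC: "t \<in> C #> x" using r[OF x] by (simp add: t_def)
    then have t: "t \<in> carrier G" using r_coset_subset_G[OF subgroup.subset[OF sub] x] by blast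
    have "x \<in> C #> t"
      using repr_independence[OF tC x sub] rcos_self[OF x sub] by simp
    then obtain c where c: "c \<in> C" "x = c \<otimes> t" by (auto simp: r_coset_def)
    have "z \<otimes> t = t \<otimes> z"
    proof (rule N(2))
      show "t \<in> r ` (rcosets C)"
        unfolding t_def by (intro imageI rcosetsI subgroup.subset[OF sub] x)
    qed (use z in blast)
    then show "z \<otimes> x = x \<otimes> z"
      using abelian[of z c] z c t open_normal_mem[OF C, of z] open_normal_mem[OF C, of c]
      by (metis IntD1 m_assoc)
  qed
qed

text \<open>Then \<open>x g x\<inverse> = w(x,g) g\<close>, so the conjugates of \<open>g\<close> under \<open>C\<close> are no more numerous than
the values.\<close>

lemma FC_if_word_is_commutator:
  assumes few: "word_values w G \<prec> (UNIV :: nat set set)"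
    and C: "open_normal C" and g: "g \<in> carrier G"
    and w: "\<And>x. x \<in> C \<Longrightarrow> eval_word G x g w = commutator x g"
  shows "g \<in> FC"
proof (rule FC_if_few_conjugates[OF C g])
  have CG: "x \<in> carrier G" if "x \<in> C" for x
    using that C open_normal_mem by blast
  have "x \<otimes> g \<otimes> inv x = eval_word G x g w \<otimes> g" if "x \<in> C" for x
    using that CG[OF that] g by (simp add: w m_assoc)
  then have "{x \<otimes> g \<otimes> inv x | x. x \<in> C} \<subseteq> (\<lambda>v. v \<otimes> g) ` word_values w G"
    using CG g by (fastforce simp: word_values_def)
  then show "{x \<otimes> g \<otimes> inv x | x. x \<in> C} \<prec> (UNIV :: nat set set)"
    using few by (meson image_lepoll lesspoll_trans1 subset_imp_lepoll)
qed

lemma eq_one_if_in_all_open_normal: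
  assumes "g \<in> carrier G" "\<And>N. open_normal N \<Longrightarrow> g \<in> N"
  shows "g = \<one>"
  using assms open_normal_separates by blast

text \<open>Take \<open>C\<close> such that \<open>w\<close> is a law on \<open>FC \<inter> C\<close>. Every finite quotient of \<open>FC \<inter> C\<close> is then abelian, and
so is \<open>FC \<inter> C\<close> itself by residual finiteness. As all values lie in \<open>FC\<close>, the word is also a law in the
finite group \<open>G / N FC\<close>, for each open normal \<open>N\<close>; so commutators lie in \<open>N FC\<close>. Hence a commutator
of elements of \<open>C\<close> is, modulo \<open>N\<close>, an element of the abelian group \<open>FC \<inter> C\<close>; letting \<open>N\<close> shrink,
commutators of elements of \<open>C\<close> commute.\<close>

lemma exists_metabelian_open_normal:
  assumes fin: "\<And>H :: nat monoid. in_variety w H \<Longrightarrow> finite (carrier H) \<Longrightarrow> comm_group H"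
    and few: "word_values w G \<prec> (UNIV :: nat set set)"
  obtains C where "open_normal C"
    "\<And>a b. a \<in> FC \<inter> C \<Longrightarrow> b \<in> FC \<inter> C \<Longrightarrow> a \<otimes> b = b \<otimes> a"
    "\<And>a b c e. \<lbrakk>a \<in> C; b \<in> C; c \<in> C; e \<in> C\<rbrakk> \<Longrightarrow>
       commutator a b \<otimes> commutator c e = commutator c e \<otimes> commutator a b"
proof -
  obtain C where C: "open_normal C" and law: "\<And>a b. a \<in> FC \<inter> C \<Longrightarrow> b \<in> FC \<inter> C \<Longrightarrow> eval_word G a b w = \<one>"
    using word_law_on_FC_near_one[OF few] by blast
  have sub: "subgroup C G" using C open_normal_subgroup by blast
  have CG: "x \<in> carrier G" if "x \<in> C" for x using that C open_normal_mem by blast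
  have FG: "x \<in> carrier G" if "x \<in> FC" for x using that by (simp add: FC_def)
  have idx: "finite (rcosets N)" if "open_normal N" for N
    using that finite_rcosets_open_subgroup by (simp add: open_normal_def normal_imp_subgroup)
  have FC_abelian: "commutator a b = \<one>" if ab: "a \<in> FC \<inter> C" "b \<in> FC \<inter> C" for a b
  proof (rule eq_one_if_in_all_open_normal)
    fix N assume N: "open_normal N"
    show "commutator a b \<in> N"
    proof (rule commutator_in_normal_if_word_law[OF fin _ open_normal_normal[OF N] idx[OF N] _ ab])
      show "subgroup (FC \<inter> C) G" by (rule subgroups_Inter_pair[OF FC_subgroup sub])
      show "eval_word G x y w \<in> N" if "x \<in> FC \<inter> C" "y \<in> FC \<inter> C" for x y
        using law[OF that] N open_normal_subgroup subgroup.one_closed by metis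
    qed
  qed (use ab CG in auto)
  have near: "\<exists>f\<in>FC \<inter> C. N #> commutator a b = N #> f"
    if N: "open_normal N" "N \<subseteq> C" and ab: "a \<in> C" "b \<in> C" for N a b
  proof -
    have subN: "subgroup N G" using N open_normal_subgroup by blast
    have "commutator a b \<in> N <#> FC"
    proof (rule commutator_in_normal_if_word_law[OF fin subgroup_self])
      show "N <#> FC \<lhd> G"
        by (rule normal_subgroup_set_mult_closed[OF open_normal_normal[OF N(1)] FC_normal])
      then show "finite (rcosets (N <#> FC))"
        using N(1) FG openin_normal_set_mult[of N FC] finite_rcosets_open_subgroup
          normal_imp_subgroup[of "N <#> FC"] by (auto simp: open_normal_def)
      show "eval_word G x y w \<in> N <#> FC" if "x \<in> carrier G" "y \<in> carrier G" for x y
      proof -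
        have "\<one> \<otimes> eval_word G x y w \<in> N <#> FC"
          unfolding set_mult_def
          using word_values_in_FC[OF few that] subgroup.one_closed[OF subN] by blast
        then show ?thesis using that by simp
      qed
    qed (use ab CG in auto)
    then obtain m f where mf: "m \<in> N" "f \<in> FC" "commutator a b = m \<otimes> f"
      by (auto simp: set_mult_def)
    have m: "m \<in> C" using mf N by blast
    have "f = inv m \<otimes> commutator a b"
      using mf FG CG[OF m] by (simp add: inv_cancel_left)
    then have "f \<in> C"
      using ab m sub by (simp add: subgroup.m_closed subgroup.m_inv_closed)
    moreover have "N #> commutator a b = N #> f"
      using mf ab CG[OF m] FG m by (subst same_coset_iff[OF subN]) (auto simp: m_assoc)
    ultimately show ?thesis using mf by blast
  qed
  have metabelian: "commutator (commutator a b) (commutator c e) = \<one>"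
    if abce: "a \<in> C" "b \<in> C" "c \<in> C" "e \<in> C" for a b c e
  proof (rule eq_one_if_in_all_open_normal)
    fix M assume M: "open_normal M"
    define N where "N = M \<inter> C"
    have N: "open_normal N" "N \<subseteq> C" "N \<subseteq> M" using M C open_normal_Int by (auto simp: N_def)
    obtain f f' where f: "f \<in> FC \<inter> C" "N #> commutator a b = N #> f"
      "f' \<in> FC \<inter> C" "N #> commutator c e = N #> f'"
      using near[OF N(1,2)] abce by meson
    have "N #> commutator (commutator a b) (commutator c e) = N #> commutator f f'"
      using normal.eval_word_cong_cosets[OF open_normal_normal[OF N(1)] _ _ _ _ f(2,4), of "Comm VarX VarY"]
        abce f CG by (simp add: Comm_def)
    also have "\<dots> = N"
      using FC_abelian[OF f(1,3)] N(1) open_normal_subgroup subgroup.subset by (metis coset_mult_one)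
    finally have "commutator (commutator a b) (commutator c e) \<in> N"
      using abce CG by (intro coset_join1[OF _ _ open_normal_subgroup[OF N(1)]]) auto
    then show "commutator (commutator a b) (commutator c e) \<in> M" using N by blast
  qed (use abce CG in auto)
  show thesis
  proof (rule that[OF C])
    show "a \<otimes> b = b \<otimes> a" if "a \<in> FC \<inter> C" "b \<in> FC \<inter> C" for a b
      using FC_abelian[OF that] that CG commutator_eq_one_iff by simp
    show "commutator a b \<otimes> commutator c e = commutator c e \<otimes> commutator a b"
      if abce: "a \<in> C" "b \<in> C" "c \<in> C" "e \<in> C" for a b c e
      using metabelian[OF abce] abce CG
        commutator_eq_one_iff[of "commutator a b" "commutator c e"] by simp
  qed
qed

text \<open>The word becomes a commutator twice: for \<open>x, g \<in> C\<close> because \<open>C\<close> is metabelian, which gives \<open>C \<subseteq> FC\<close> and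
thus makes \<open>C\<close> abelian; and then for \<open>x \<in> C\<close> and arbitrary \<open>g\<close>, because the two commutators inside
\<open>v\<close> lie in the abelian normal subgroup \<open>C\<close>, which gives \<open>FC = G\<close>.\<close>

lemma finite_derived_if_few_olshanskii_values:
  assumes h: "h mod 10 = 1"
    and fin: "\<And>H :: nat monoid. in_variety (olshanskii_word d n h) H \<Longrightarrow> finite (carrier H) \<Longrightarrow> comm_group H"
    and few: "word_values (olshanskii_word d n h) G \<prec> (UNIV :: nat set set)"
  shows "finite (derived G (carrier G))"
proof -
  obtain C where C: "open_normal C"
    and FC_abelian: "\<And>a b. a \<in> FC \<inter> C \<Longrightarrow> b \<in> FC \<inter> C \<Longrightarrow> a \<otimes> b = b \<otimes> a"
    and metabelian: "\<And>a b c e. \<lbrakk>a \<in> C; b \<in> C; c \<in> C; e \<in> C\<rbrakk> \<Longrightarrow>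
       commutator a b \<otimes> commutator c e = commutator c e \<otimes> commutator a b"
    using exists_metabelian_open_normal[OF fin few] by blast
  interpret C: normal C G using C by (rule open_normal_normal)
  have pow: "x [^] (k :: int) \<in> C" if "x \<in> C" for x k
    using subgroup_int_pow_closed[OF C.subgroup_axioms that] .
  have "C \<subseteq> FC"
  proof
    fix g assume g: "g \<in> C"
    show "g \<in> FC"
    proof (rule FC_if_word_is_commutator[OF few C])
      show "eval_word G x g (olshanskii_word d n h) = commutator x g" if "x \<in> C" for x
        by (rule olshanskii_word_eq_commutator[OF _ _ h metabelian]) (use that g pow in auto)
    qed (use g in auto)
  qed
  then have abelian: "a \<otimes> b = b \<otimes> a" if "a \<in> C" "b \<in> C" for a b
    using FC_abelian that by blast
  have comm_in_C: "commutator x g \<in> C" "commutator g x \<in> C" if "x \<in> C" "g \<in> carrier G" for x g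
  proof -
    have "x \<otimes> (g \<otimes> inv x \<otimes> inv g) \<in> C" "g \<otimes> x \<otimes> inv g \<otimes> inv x \<in> C"
      using that by (auto intro!: C.m_closed C.inv_op_closed2)
    moreover have "commutator x g = x \<otimes> (g \<otimes> inv x \<otimes> inv g)"
      using that by (simp add: m_assoc)
    ultimately show "commutator x g \<in> C" "commutator g x \<in> C" by simp_all
  qed
  have "FC = carrier G"
  proof
    show "carrier G \<subseteq> FC"
    proof
      fix g assume g: "g \<in> carrier G"
      show "g \<in> FC"
      proof (rule FC_if_word_is_commutator[OF few C g])
        show "eval_word G x g (olshanskii_word d n h) = commutator x g" if "x \<in> C" for x
          by (rule olshanskii_word_eq_commutator[OF _ g h abelian[OF comm_in_C(1) comm_in_C(2)]])
            (use that g pow in auto)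
      qed
    qed
  qed (auto simp: FC_def)
  then show ?thesis
    using finite_derived_if_abelian_open_normal_and_FC[OF C abelian] by blast
qed

end

theorem theorem3p4:
  fixes G :: "('a, 'b) monoid_scheme" and T :: "'a topology" and d n h :: nat
  assumes "olshanskii_parameters d n h"
    and "profinite_group G T"
    and "word_values (olshanskii_word d n h) G \<prec> (UNIV :: nat set set)"
  shows "finite (verbal_subgroup (olshanskii_word d n h) G T)"
proof -
  interpret profinite G T
    using assms(2) by (simp add: profinite_def profinite_axioms_def profinite_group_def)
  let ?D = "generate G (word_values (olshanskii_word d n h) G)"
  have "?D \<subseteq> derived G (carrier G)"
    using olshanskii_word_in_derived
    by (intro generate_subgroup_incl derived_is_subgroup) (auto simp: word_values_def)
  moreover have "finite (derived G (carrier G))"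
    using assms(1,3) by (intro finite_derived_if_few_olshanskii_values) (auto simp: olshanskii_parameters_def)
  ultimately have fin: "finite ?D" by (rule finite_subset)
  moreover have "?D \<subseteq> topspace T"
    by (simp, rule generate_incl) (auto simp: word_values_def)
  ultimately have "closedin T ?D"
    using Hausdorff closedin_Hausdorff_finite by blast
  then show ?thesis
    using fin by (simp add: verbal_subgroup_def closure_of_closedin)
qed

end
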